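(* Let $\star$ be a link map, $n\ge1$, let $f,g\colon X\to Y$ be measurable and let $\mu,\nu$ be monotone measures on $(X,\mathcal{A})$. Then: (a) If $\mu(\{f\ge t\})\le\mu(\{g\ge t\})$ for all $t$, then $\mathrm{Su}_{\star}^{n}(\mu,f)\le\mathrm{Su}_{\star}^{n}(\mu,g)$. (b) If $\mu(A)\le\nu(A)$ for all $A\in\mathcal{A}$, then $\mathrm{Su}_{\star}^{n}(\mu,f)\le\mathrm{Su}_{\star}^{n}(\nu,f)$. (c) $\mathrm{Su}_{\star}^{n}(\mu,a\mathbb{1}_A)=s_n(a,\mu(A))$ for all $a\in Y$ and $A\in\mathcal{A}$, where $s_n\colon Y\times[0,\infty]\to Y$ ($n\ge1$) are nondecreasing functions such that $s_n(a,0)=s_n(0,b)=0$ and $s_{n+1}(a,b)=a\wedge[b\star s_n(a,b)]$ for all $a\in Y$, $b\in[0,\infty]$.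
   Context: $(X,\mathcal{A})$ is a measurable space with $X\neq\emptyset$ ($\mathcal{A}$ a $\sigma$-algebra), and $Y=[0,\bar y]$ with $0<\bar y\le\infty$. Notation: $a\wedge b=\min(a,b)$, $\{f\ge t\}=\{x\in X: f(x)\ge t\}$, $\mathbb{1}_A$ is the indicator function of $A$. A function of two variables is nondecreasing if it is nondecreasing in the componentwise order. A monotone measure on $(X,\mathcal{A})$ is a set function $\mu\colon\mathcal{A}\to[0,\infty]$ with $\mu(A)\le\mu(B)$ whenever $A\subset B$, $\mu(\emptyset)=0$ and $\mu(X)>0$. A link map is a nondecreasing map $\star\colon[0,\infty]\times Y\to[0,\infty]$ (i.e. $a_1\star a_2\le b_1\star b_2$ whenever $a_i\le b_i$) such that $0\star a\le a$ for all $a\in Y$. The lower $n$-Sugeno integral of a measurable $f\colon X\to Y$ is defined recursively by $$\mathrm{Su}_{\star}^{1}(\mu,f)=\sup_{t\in Y}\{t\wedge\mu(\{f\ge t\})\},\qquad \mathrm{Su}_{\star}^{n+1}(\mu,f)=\sup_{t\in Y}\big\{t\wedge\big(\mu(\{f\ge t\})\star\mathrm{Su}_{\star}^{n}(\mu,f)\big)\big\}.$$ *)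

theory Defs
  imports "HOL-Analysis.Analysis" "HOL-Library.Product_Order"
begin

text \<open>
  A measurable space is given, as in the library, by a value of type \<open>'a measure\<close>, of which only
  \<^const>\<open>space\<close> and \<^const>\<open>sets\<close> are used. Set functions are total on \<open>'a set\<close> and constrained
  on \<^const>\<open>sets\<close> only.
\<close>

definition monotone_measure :: "'a measure \<Rightarrow> ('a set \<Rightarrow> ennreal) \<Rightarrow> bool" where
  "monotone_measure M \<mu> \<longleftrightarrow> mono_on (sets M) \<mu> \<and> \<mu> {} = 0 \<and> 0 < \<mu> (space M)"

text \<open>
  Pairs carry the componentwise order of \<^theory>\<open>HOL-Library.Product_Order\<close>. A link map is defined
  on \<open>[0, \<infinity>] \<times> Y\<close>; its values at second arguments outside \<open>Y\<close> are irrelevant.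
\<close>

definition link_map :: "ennreal set \<Rightarrow> (ennreal \<Rightarrow> ennreal \<Rightarrow> ennreal) \<Rightarrow> bool" where
  "link_map Y star \<longleftrightarrow>
     mono_on (UNIV \<times> Y) (\<lambda>(x, y). star x y) \<and> (\<forall>a\<in>Y. star 0 a \<le> a)"

text \<open>The index starts at 1; the value at index 0 is a dummy.\<close>

fun lower_Sugeno ::
  "ennreal set \<Rightarrow> (ennreal \<Rightarrow> ennreal \<Rightarrow> ennreal) \<Rightarrow> 'a measure \<Rightarrow> nat
     \<Rightarrow> ('a set \<Rightarrow> ennreal) \<Rightarrow> ('a \<Rightarrow> ennreal) \<Rightarrow> ennreal" where
  "lower_Sugeno Y star M 0 \<mu> f = 0"
| "lower_Sugeno Y star M (Suc 0) \<mu> f =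
     (SUP t\<in>Y. min t (\<mu> {x \<in> space M. f x \<ge> t}))"
| "lower_Sugeno Y star M (Suc (Suc n)) \<mu> f =
     (SUP t\<in>Y. min t (star (\<mu> {x \<in> space M. f x \<ge> t}) (lower_Sugeno Y star M (Suc n) \<mu> f)))"

end

theory Submission
  imports Defs
begin

text \<open>
  The three claims are inductions on \<open>n\<close> along the recursion of the integral.

  Claims (a) and (b) are one comparison: the integral sees \<open>\<mu>\<close> and \<open>f\<close> only through the level
  function \<open>t \<mapsto> \<mu> {f \<ge> t}\<close> and depends on it monotonically, the link map being nondecreasing
  (\<open>lower_Sugeno_mono\<close>). The link map is controlled on \<open>[0, \<infinity>] \<times> Y\<close> only, so the
  induction also needs every iterated integral to lie in \<open>Y\<close>; this holds because each value is a
  supremum of numbers below some \<open>t \<in> Y\<close>.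

  For claim (c), the level function of \<open>a * indicator A\<close> is \<open>\<mu> A\<close> on \<open>(0, a]\<close> and \<open>0\<close>
  above \<open>a\<close>. In the step from \<open>s\<close> to the next integral, the levels in \<open>(0, a]\<close> contribute
  \<open>min a (star (\<mu> A) s)\<close>, attained at \<open>t = a\<close>. The levels above \<open>a\<close> contribute at most
  \<open>star 0 s\<close>, which cannot exceed that value: \<open>star 0 s \<le> s \<le> a\<close> is the defining bound of
  link maps, and \<open>star 0 s \<le> star (\<mu> A) s\<close> is monotonicity.
\<close>

lemma link_map_mono:
  assumes "link_map Y star" "x \<le> x'" "y \<le> y'" "y \<in> Y" "y' \<in> Y"
  shows "star x y \<le> star x' y'"
  using assms(1) mono_onD[of "UNIV \<times> Y" "\<lambda>(x, y). star x y" "(x, y)" "(x', y')"] assms(2-)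
  unfolding link_map_def by auto

lemma lower_Sugeno_in_range:
  "lower_Sugeno {0..ybar} star M n \<mu> f \<in> {0..ybar}"
  by (cases "({0..ybar}, star, M, n, \<mu>, f)" rule: lower_Sugeno.cases)
     (auto intro!: SUP_least intro: min.coboundedI1)

text \<open>
  Letting the measure and the integrand vary together gives (a) for \<open>\<mu> = \<nu>\<close> and (b) for
  \<open>f = g\<close>.
\<close>

lemma lower_Sugeno_mono:
  fixes ybar :: ennreal
  assumes link: "link_map {0..ybar} star"
    and level: "\<And>t. t \<in> {0..ybar} \<Longrightarrow>
      \<mu> {x \<in> space M. f x \<ge> t} \<le> \<nu> {x \<in> space M. g x \<ge> t}"
  shows "lower_Sugeno {0..ybar} star M n \<mu> f \<le> lower_Sugeno {0..ybar} star M n \<nu> g"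
proof (induction n)
  case 0
  show ?case by simp
next
  case (Suc n)
  show ?case
  proof (cases n)
    case 0
    then show ?thesis
      using level by (auto intro!: SUP_subset_mono min.mono)
  next
    case (Suc m)
    have "min t (star (\<mu> {x \<in> space M. f x \<ge> t}) (lower_Sugeno {0..ybar} star M n \<mu> f))
        \<le> min t (star (\<nu> {x \<in> space M. g x \<ge> t}) (lower_Sugeno {0..ybar} star M n \<nu> g))"
      if "t \<in> {0..ybar}" for t
      by (intro min.mono order_refl link_map_mono[OF link] level that Suc.IH
          lower_Sugeno_in_range)
    then show ?thesis
      unfolding Suc lower_Sugeno.simps by (intro SUP_subset_mono) (auto simp: Suc)
  qed
qed

text \<open>
  The integral of \<open>a * indicator A\<close> in closed form, with \<open>b\<close> standing for the measure of \<open>A\<close>.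
\<close>

fun step_Sugeno :: "(ennreal \<Rightarrow> ennreal \<Rightarrow> ennreal) \<Rightarrow> nat \<Rightarrow> ennreal \<Rightarrow> ennreal \<Rightarrow> ennreal" where
  "step_Sugeno star 0 a b = 0"
| "step_Sugeno star (Suc 0) a b = min a b"
| "step_Sugeno star (Suc (Suc n)) a b = min a (star b (step_Sugeno star (Suc n) a b))"

lemma step_Sugeno_le: "step_Sugeno star n a b \<le> a"
  by (cases "(star, n, a, b)" rule: step_Sugeno.cases) auto

lemma step_Sugeno_in_range: "a \<in> {0..ybar} \<Longrightarrow> step_Sugeno star n a b \<in> {0..ybar}"
  using step_Sugeno_le[of star n a b] by auto

lemma step_Sugeno_Suc:
  "n \<ge> 1 \<Longrightarrow> step_Sugeno star (Suc n) a b = min a (star b (step_Sugeno star n a b))"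
  by (cases n) auto

lemma step_Sugeno_zero_height: "step_Sugeno star n 0 b = 0"
  using step_Sugeno_le[of star n 0 b] by simp

lemma step_Sugeno_zero_measure:
  assumes "link_map {0..ybar} star"
  shows "step_Sugeno star n a 0 = 0"
proof (induction n)
  case (Suc n)
  have "star 0 0 \<le> 0"
    using assms unfolding link_map_def by (metis atLeastAtMost_iff order_refl zero_le)
  then show ?case
    using Suc by (cases n) auto
qed simp

lemma step_Sugeno_mono:
  assumes link: "link_map {0..ybar} star"
    and "a \<le> a'" "a' \<in> {0..ybar}" "b \<le> b'"
  shows "step_Sugeno star n a b \<le> step_Sugeno star n a' b'"
proof (induction n)
  case (Suc n)
  have a: "a \<in> {0..ybar}" using assms(2,3) by auto
  show ?case
  proof (cases n)
    case 0
    then show ?thesis using assms by (simp add: min.mono del: min.bounded_iff)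
  next
    case (Suc m)
    then have "n \<ge> 1" by simp
    then show ?thesis
      unfolding step_Sugeno_Suc[OF \<open>n \<ge> 1\<close>]
      by (intro min.mono link_map_mono[OF link] assms Suc.IH step_Sugeno_in_range a)
  qed
qed simp

text \<open>
  The step of the recursion for \<open>a * indicator A\<close>: \<open>p\<close> and \<open>q\<close> are the values obtained from
  levels up to the height \<open>a\<close> and above it. The bounds on \<open>q\<close> make the maximum occur at
  \<open>t = a\<close>. At \<open>t = 0\<close> the superlevel set is the whole space, not \<open>A\<close>, so \<open>F 0\<close> may differ from
  \<open>p\<close>; the factor \<open>min 0\<close> absorbs it.
\<close>

lemma SUP_min_step:
  fixes Y :: "ennreal set"
  assumes "a \<in> Y"
    and below: "\<And>t. 0 < t \<Longrightarrow> t \<le> a \<Longrightarrow> F t = p"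
    and above: "\<And>t. a < t \<Longrightarrow> F t = q"
    and "q \<le> a" "q \<le> p"
  shows "(SUP t\<in>Y. min t (F t)) = min a p"
proof (rule antisym)
  show "(SUP t\<in>Y. min t (F t)) \<le> min a p"
  proof (rule SUP_least)
    fix t
    consider "t = 0" | "0 < t" "t \<le> a" | "a < t"
      by (metis not_gr_zero not_le_imp_less)
    then show "min t (F t) \<le> min a p"
    proof cases
      case 1
      then show ?thesis by simp
    next
      case 2
      then show ?thesis using below[of t] by (simp add: min.mono del: min.bounded_iff)
    next
      case 3
      then show ?thesis using above[of t] assms(4,5) by (auto intro: min.coboundedI2)
    qed
  qed
  have "min a p \<le> min a (F a)"
    using below[of a] by (cases "a = 0") (auto simp: zero_less_iff_neq_zero)
  also have "\<dots> \<le> (SUP t\<in>Y. min t (F t))"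
    using assms(1) by (rule SUP_upper)
  finally show "min a p \<le> (SUP t\<in>Y. min t (F t))" .
qed

lemma superlevel_indicator_below:
  fixes a t :: ennreal
  assumes "A \<in> sets M" "0 < t" "t \<le> a"
  shows "{x \<in> space M. a * indicator A x \<ge> t} = A"
  using assms sets.sets_into_space[OF assms(1)] by (auto simp: indicator_def split: if_splits)

lemma superlevel_indicator_above:
  fixes a t :: ennreal
  assumes "a < t"
  shows "{x \<in> space M. a * indicator A x \<ge> t} = {}"
  using assms by (auto simp: indicator_def split: if_splits)

lemma lower_Sugeno_indicator:
  assumes link: "link_map {0..ybar} star"
    and empty: "\<kappa> {} = 0" and a: "a \<in> {0..ybar}" and A: "A \<in> sets M"
  shows "lower_Sugeno {0..ybar} star M n \<kappa> (\<lambda>x. a * indicator A x) = step_Sugeno star n a (\<kappa> A)"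
proof (induction n)
  case 0
  show ?case by simp
next
  case (Suc n)
  note level = superlevel_indicator_below[OF A] superlevel_indicator_above empty
  show ?case
  proof (cases n)
    case 0
    show ?thesis
      unfolding 0 lower_Sugeno.simps step_Sugeno.simps
      by (rule SUP_min_step[where q = 0]) (use a in \<open>simp_all add: level\<close>)
  next
    case (Suc m)
    define s where "s = step_Sugeno star n a (\<kappa> A)"
    have s: "s \<in> {0..ybar}" "s \<le> a"
      unfolding s_def using step_Sugeno_in_range[OF a] step_Sugeno_le by auto
    \<comment> \<open>The levels above \<open>a\<close> contribute at most \<open>star 0 s\<close>, which lies below both arguments of the minimum.\<close>
    have "star 0 s \<le> a"
      using link s unfolding link_map_def by (meson order_trans)
    moreover have "star 0 s \<le> star (\<kappa> A) s"
      by (rule link_map_mono[OF link]) (use s in auto)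
    ultimately have "(SUP t\<in>{0..ybar}. min t (star (\<kappa> {x \<in> space M. a * indicator A x \<ge> t}) s))
        = min a (star (\<kappa> A) s)"
      by (intro SUP_min_step[where q = "star 0 s"]) (use a in \<open>simp_all add: level\<close>)
    then show ?thesis
      using Suc.IH unfolding s_def Suc by simp
  qed
qed

theorem proposition4p2:
  fixes ybar :: ennreal and Y :: "ennreal set"
    and star :: "ennreal \<Rightarrow> ennreal \<Rightarrow> ennreal"
    and M :: "'a measure" and \<mu> \<nu> :: "'a set \<Rightarrow> ennreal"
    and f g :: "'a \<Rightarrow> ennreal" and n :: nat
  assumes "space M \<noteq> {}"
    and "0 < ybar" and "Y = {0..ybar}"
    and "link_map Y star"
    and "n \<ge> 1"
    and "f \<in> M \<rightarrow>\<^sub>M restrict_space borel Y" and "g \<in> M \<rightarrow>\<^sub>M restrict_space borel Y"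
    and "monotone_measure M \<mu>" and "monotone_measure M \<nu>"
  shows "((\<forall>t\<in>Y. \<mu> {x \<in> space M. f x \<ge> t} \<le> \<mu> {x \<in> space M. g x \<ge> t})
            \<longrightarrow> lower_Sugeno Y star M n \<mu> f \<le> lower_Sugeno Y star M n \<mu> g)
       \<and> ((\<forall>A\<in>sets M. \<mu> A \<le> \<nu> A)
            \<longrightarrow> lower_Sugeno Y star M n \<mu> f \<le> lower_Sugeno Y star M n \<nu> f)
       \<and> (\<exists>s :: nat \<Rightarrow> ennreal \<Rightarrow> ennreal \<Rightarrow> ennreal.
            (\<forall>k\<ge>1.
               (\<forall>a\<in>Y. \<forall>b. s k a b \<in> Y)
             \<and> mono_on (Y \<times> UNIV) (\<lambda>(a, b). s k a b)
             \<and> (\<forall>a\<in>Y. s k a 0 = 0) \<and> (\<forall>b. s k 0 b = 0)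
             \<and> (\<forall>a\<in>Y. \<forall>b. s (Suc k) a b = min a (star b (s k a b))))
          \<and> (\<forall>\<kappa>. monotone_measure M \<kappa> \<longrightarrow>
               (\<forall>k\<ge>1. \<forall>a\<in>Y. \<forall>A\<in>sets M.
                  lower_Sugeno Y star M k \<kappa> (\<lambda>x. a * indicator A x) = s k a (\<kappa> A))))"
proof (intro conjI)
  note Y = \<open>Y = {0..ybar}\<close>
  have link: "link_map {0..ybar} star"
    using \<open>link_map Y star\<close> Y by simp
  show "(\<forall>t\<in>Y. \<mu> {x \<in> space M. f x \<ge> t} \<le> \<mu> {x \<in> space M. g x \<ge> t})
      \<longrightarrow> lower_Sugeno Y star M n \<mu> f \<le> lower_Sugeno Y star M n \<mu> g"
    using lower_Sugeno_mono[OF link] unfolding Y by blast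
  have "f \<in> borel_measurable M"
    using \<open>f \<in> M \<rightarrow>\<^sub>M restrict_space borel Y\<close> by (simp add: measurable_restrict_space2_iff)
  then have level: "{x \<in> space M. f x \<ge> t} \<in> sets M" for t
    by measurable
  show "(\<forall>A\<in>sets M. \<mu> A \<le> \<nu> A)
      \<longrightarrow> lower_Sugeno Y star M n \<mu> f \<le> lower_Sugeno Y star M n \<nu> f"
    using lower_Sugeno_mono[OF link] level unfolding Y by blast
  have mono: "mono_on (Y \<times> UNIV) (\<lambda>(a, b). step_Sugeno star k a b)" for k
    unfolding Y by (auto intro!: mono_onI step_Sugeno_mono[OF link])
  show "\<exists>s :: nat \<Rightarrow> ennreal \<Rightarrow> ennreal \<Rightarrow> ennreal.
      (\<forall>k\<ge>1.
         (\<forall>a\<in>Y. \<forall>b. s k a b \<in> Y)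
       \<and> mono_on (Y \<times> UNIV) (\<lambda>(a, b). s k a b)
       \<and> (\<forall>a\<in>Y. s k a 0 = 0) \<and> (\<forall>b. s k 0 b = 0)
       \<and> (\<forall>a\<in>Y. \<forall>b. s (Suc k) a b = min a (star b (s k a b))))
    \<and> (\<forall>\<kappa>. monotone_measure M \<kappa> \<longrightarrow>
         (\<forall>k\<ge>1. \<forall>a\<in>Y. \<forall>A\<in>sets M.
            lower_Sugeno Y star M k \<kappa> (\<lambda>x. a * indicator A x) = s k a (\<kappa> A)))"
    using step_Sugeno_in_range step_Sugeno_zero_measure[OF link] step_Sugeno_zero_height
      step_Sugeno_Suc mono lower_Sugeno_indicator[OF link]
    unfolding Y monotone_measure_def
    by (intro exI[of _ "step_Sugeno star"]) blast
qed

end
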